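(* Let the intensities be $$\lambda^{(m)}(t)=\mu^{(m)} s(h(t))+\sum_{l=1}^M\ \sum_{i:\,t_{l,i}\le t-1}Y^{(l)}_{t_{l,i}}\Big(K_{l,m}+\alpha_{l,m}\mathbf 1(t_{l,i}\in A^{(l)})\Big)\beta(1-\beta)^{t-t_{l,i}-1}.$$ For each $l\in\{1,\dots,M\}$ define $R^3(1,l):=R^3_a(1,l):=0$ and, for $t=1,\dots,N_\delta-1$, $$R^3(t+1,l)=(1-\beta)R^3(t,l)+Y_t^{(l)}\beta,\qquad R^3_a(t+1,l)=(1-\beta)R^3_a(t,l)+Y_t^{(l)}\mathbf 1(t\in A^{(l)})\beta.$$ Then for every $m\in\{1,\dots,M\}$ and every $t\in\{1,\dots,N_\delta\}$, $$\lambda^{(m)}(t)=\mu^{(m)}s(h(t))+\sum_{l=1}^MK_{l,m}R^3(t,l)+\sum_{l=1}^M\alpha_{l,m}R^3_a(t,l).$$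
   Context: Fix integers $M\ge1$ (number of dimensions) and $N_\delta\ge1$ (number of discrete time steps). For $l\in\{1,\dots,M\}$ and $t\in\{1,\dots,N_\delta\}$, $Y_t^{(l)}\in\{0,1,2,\dots\}$ is the number of events in dimension $l$ at time step $t$. The set of arrival times in dimension $l$ is $\tau^{(l)}=\{t: Y^{(l)}_t>0\}=\{t_{l,1}<\dots<t_{l,N_l}\}$; $A^{(l)}\subseteq\tau^{(l)}$ is the set of arrival times in dimension $l$ at which an alarm was sounded. The function $h:\{1,\dots,N_\delta\}\to\{1,\dots,24\}$ gives the hour of day of a time step and $s:\{1,\dots,24\}\to(0,1)$ is a fixed known function. The parameters satisfy $\mu^{(m)}>0$, $K_{l,m}>0$, $\alpha_{l,m}>0$, $\beta\in(0,1)$. $\mathbf 1(\cdot)$ is the indicator function. *)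

theory Defs
  imports Complex_Main "HOL-Library.FuncSet" "HOL-Library.Indicator_Function"
begin

text \<open>
  Dimensions are the numbers \<open>1..M\<close> and time steps the numbers \<open>1..N\<close>; \<open>Y l t\<close> is the number of
  events in dimension \<open>l\<close> at time step \<open>t\<close>. Values of \<open>Y\<close> at other indices never matter.
\<close>

definition arrival_times :: "nat \<Rightarrow> (nat \<Rightarrow> nat \<Rightarrow> nat) \<Rightarrow> nat \<Rightarrow> nat set" where
  "arrival_times N Y l = {t \<in> {1..N}. Y l t > 0}"

text \<open>
  The \<open>i\<close>-th smallest arrival time, \<open>t\<^sub>l\<^sub>,\<^sub>i\<close>, counted from \<open>i = 1\<close>; it is meaningful only for
  \<open>1 \<le> i \<le> card (arrival_times N Y l)\<close>.
\<close>

definition arrival_time :: "nat \<Rightarrow> (nat \<Rightarrow> nat \<Rightarrow> nat) \<Rightarrow> nat \<Rightarrow> nat \<Rightarrow> nat" where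
  "arrival_time N Y l i = sorted_list_of_set (arrival_times N Y l) ! (i - 1)"

text \<open>
  Only time steps \<open>t \<ge> 1\<close> are of interest, and every summand has \<open>arrival_time N Y l i \<le> t - 1\<close>, so
  the truncated subtractions on natural numbers below are all genuine. \<open>A l\<close> is the set of alarm
  times in dimension \<open>l\<close>.
\<close>

definition intensity ::
  "nat \<Rightarrow> nat \<Rightarrow> (nat \<Rightarrow> nat \<Rightarrow> nat) \<Rightarrow> (nat \<Rightarrow> nat set) \<Rightarrow> (nat \<Rightarrow> nat) \<Rightarrow> (nat \<Rightarrow> real) \<Rightarrow>
   (nat \<Rightarrow> real) \<Rightarrow> (nat \<Rightarrow> nat \<Rightarrow> real) \<Rightarrow> (nat \<Rightarrow> nat \<Rightarrow> real) \<Rightarrow> real \<Rightarrow> nat \<Rightarrow> nat \<Rightarrow> real" where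
  "intensity M N Y A h s \<mu> K \<alpha> \<beta> m t =
     \<mu> m * s (h t) +
     (\<Sum>l = 1..M. \<Sum>i | i \<in> {1..card (arrival_times N Y l)} \<and> arrival_time N Y l i \<le> t - 1.
        real (Y l (arrival_time N Y l i)) *
        (K l m + \<alpha> l m * indicator (A l) (arrival_time N Y l i)) *
        (\<beta> * (1 - \<beta>) ^ (t - arrival_time N Y l i - 1)))"

end

theory Submission
  imports Defs
begin

text \<open>
  Time steps without events contribute nothing, so the sum over the arrival times before \<open>t\<close> is a
  sum over all time steps \<open>u < t\<close>, and unrolling the recursions of \<open>R\<^sup>3\<close> and \<open>R\<^sup>3\<^sub>a\<close> produces
  exactly such sums with the geometric weights \<open>\<beta> (1 - \<beta>)\<^bsup>t - u - 1\<^esup>\<close>.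
\<close>

lemma finite_arrival_times [simp]: "finite (arrival_times N Y l)"
  by (simp add: arrival_times_def)

text \<open>The sorted list of a finite set has no repetitions, so \<open>nth\<close> is a bijection
  from its positions; the shift by one reconciles positions counted from 0 with arrival times
  counted from 1.\<close>

lemma bij_betw_arrival_time:
  "bij_betw (arrival_time N Y l) {1..card (arrival_times N Y l)} (arrival_times N Y l)"
proof -
  let ?T = "arrival_times N Y l"
  have "bij_betw (nth (sorted_list_of_set ?T)) {..<card ?T} ?T"
    by (rule bij_betw_nth) simp_all
  moreover have "bij_betw (\<lambda>i. i - 1) {1..card ?T} {..<card ?T}"
    by (rule bij_betw_byWitness[where f' = Suc]) auto
  ultimately have "bij_betw (nth (sorted_list_of_set ?T) \<circ> (\<lambda>i. i - 1)) {1..card ?T} ?T"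
    by (rule bij_betw_trans[rotated])
  then show ?thesis
    by (simp add: arrival_time_def[abs_def] comp_def)
qed

lemma sum_arrival_times_before:
  fixes g :: "nat \<Rightarrow> 'a::comm_monoid_add"
  assumes t: "t \<in> {1..N}" and zero: "\<And>u. Y l u = 0 \<Longrightarrow> g u = 0"
  shows "(\<Sum>i | i \<in> {1..card (arrival_times N Y l)} \<and> arrival_time N Y l i \<le> t - 1.
            g (arrival_time N Y l i)) = (\<Sum>u = 1..<t. g u)"
proof -
  let ?I = "{1..card (arrival_times N Y l)}" and ?f = "arrival_time N Y l"
  have "(\<Sum>i | i \<in> ?I \<and> ?f i \<le> t - 1. g (?f i)) =
      (\<Sum>i\<in>?I. if ?f i \<le> t - 1 then g (?f i) else 0)"
    by (intro sum.inter_filter) simp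
  also have "\<dots> = (\<Sum>u\<in>arrival_times N Y l. if u \<le> t - 1 then g u else 0)"
    by (rule sum.reindex_bij_betw[OF bij_betw_arrival_time])
  also have "\<dots> = (\<Sum>u | u \<in> arrival_times N Y l \<and> u \<le> t - 1. g u)"
    by (intro sum.inter_filter[symmetric]) simp
  also have "\<dots> = (\<Sum>u = 1..<t. g u)"
    \<comment> \<open>Since \<open>t\<close> is at most \<open>N\<close>, a \<open>u\<close> in
      \<open>{1..<t}\<close> that is not an arrival time must have \<open>Y l u = 0\<close>, and
      there \<open>g\<close> vanishes.\<close>
    using t zero by (intro sum.mono_neutral_left) (auto simp: arrival_times_def)
  finally show ?thesis .
qed

text \<open>Each step multiplies all earlier weights by \<open>q\<close> and adds one input with
  weight \<open>b\<close>. Leaving the input \<open>x\<close> arbitrary covers both recursions of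
  the theorem, with and without the alarm indicator.\<close>

lemma linear_recurrence_eq_sum:
  fixes r x :: "nat \<Rightarrow> 'a::comm_semiring_1"
  assumes "r 1 = 0"
    and rec: "\<And>t. t \<in> {1..N - 1} \<Longrightarrow> r (t + 1) = q * r t + x t * b"
    and t: "t \<in> {1..N}"
  shows "r t = (\<Sum>u = 1..<t. x u * (b * q ^ (t - u - 1)))"
proof -
  have "1 \<le> t" using t by simp
  then show ?thesis using t
  proof (induction t rule: dec_induct)
    case base
    show ?case using \<open>r 1 = 0\<close> by simp
  next
    case (step t)
    have "r (Suc t) = q * r t + x t * b"
      using rec[of t] step by simp
    also have "q * r t = (\<Sum>u = 1..<t. x u * (b * q ^ (Suc t - u - 1)))"
    proof -
      have "q * r t = (\<Sum>u = 1..<t. q * (x u * (b * q ^ (t - u - 1))))"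
        using step by (simp add: sum_distrib_left)
      also have "\<dots> = (\<Sum>u = 1..<t. x u * (b * q ^ (Suc t - u - 1)))"
      proof (rule sum.cong)
        fix u assume "u \<in> {1..<t}"
        \<comment> \<open>The truncated subtraction is harmless because
          \<open>u < t\<close>.\<close>
        then have "Suc t - u - 1 = Suc (t - u - 1)" by auto
        then show "q * (x u * (b * q ^ (t - u - 1))) = x u * (b * q ^ (Suc t - u - 1))"
          by (simp only: power_Suc mult_ac)
      qed simp
      finally show ?thesis .
    qed
    \<comment> \<open>The remaining term \<open>x t * b\<close> is the summand at
      \<open>u = t\<close>, whose exponent \<open>Suc t - t - 1\<close> is 0.\<close>
    finally show ?case
      using step by simp
  qed
qed

theorem lemma6p1:
  fixes M N :: nat
    and Y :: "nat \<Rightarrow> nat \<Rightarrow> nat"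
    and A :: "nat \<Rightarrow> nat set"
    and h :: "nat \<Rightarrow> nat"
    and s :: "nat \<Rightarrow> real"
    and \<mu> :: "nat \<Rightarrow> real"
    and K \<alpha> :: "nat \<Rightarrow> nat \<Rightarrow> real"
    and \<beta> :: real
    and R3 R3a :: "nat \<Rightarrow> nat \<Rightarrow> real"
  assumes "M \<ge> 1" and "N \<ge> 1"
    and "\<And>l. l \<in> {1..M} \<Longrightarrow> A l \<subseteq> arrival_times N Y l"
    and "h \<in> {1..N} \<rightarrow> {1..24}"
    and "s \<in> {1..24} \<rightarrow> {0<..<1}"
    and "\<And>m. m \<in> {1..M} \<Longrightarrow> \<mu> m > 0"
    and "\<And>l m. l \<in> {1..M} \<Longrightarrow> m \<in> {1..M} \<Longrightarrow> K l m > 0"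
    and "\<And>l m. l \<in> {1..M} \<Longrightarrow> m \<in> {1..M} \<Longrightarrow> \<alpha> l m > 0"
    and "0 < \<beta>" and "\<beta> < 1"
    and "\<And>l. l \<in> {1..M} \<Longrightarrow> R3 1 l = 0"
    and "\<And>l. l \<in> {1..M} \<Longrightarrow> R3a 1 l = 0"
    and "\<And>l t. l \<in> {1..M} \<Longrightarrow> t \<in> {1..N - 1} \<Longrightarrow>
           R3 (t + 1) l = (1 - \<beta>) * R3 t l + real (Y l t) * \<beta>"
    and "\<And>l t. l \<in> {1..M} \<Longrightarrow> t \<in> {1..N - 1} \<Longrightarrow>
           R3a (t + 1) l = (1 - \<beta>) * R3a t l + real (Y l t) * indicator (A l) t * \<beta>"
  shows "\<forall>m \<in> {1..M}. \<forall>t \<in> {1..N}.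
           intensity M N Y A h s \<mu> K \<alpha> \<beta> m t =
             \<mu> m * s (h t) + (\<Sum>l = 1..M. K l m * R3 t l) + (\<Sum>l = 1..M. \<alpha> l m * R3a t l)"
proof (intro ballI)
  fix m t assume m: "m \<in> {1..M}" and t: "t \<in> {1..N}"
  let ?w = "\<lambda>u. \<beta> * (1 - \<beta>) ^ (t - u - 1)"
  have "(\<Sum>i | i \<in> {1..card (arrival_times N Y l)} \<and> arrival_time N Y l i \<le> t - 1.
        real (Y l (arrival_time N Y l i)) *
        (K l m + \<alpha> l m * indicator (A l) (arrival_time N Y l i)) *
        ?w (arrival_time N Y l i)) = K l m * R3 t l + \<alpha> l m * R3a t l"
    (is "?S = _") if l: "l \<in> {1..M}" for l
  proof -
    have R3: "R3 t l = (\<Sum>u = 1..<t. real (Y l u) * ?w u)"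
      using assms(11)[OF l] assms(13)[OF l] t
      by (rule linear_recurrence_eq_sum[where r = "\<lambda>t. R3 t l"])
    have R3a: "R3a t l = (\<Sum>u = 1..<t. real (Y l u) * indicator (A l) u * ?w u)"
      using assms(12)[OF l] assms(14)[OF l] t
      by (rule linear_recurrence_eq_sum[where r = "\<lambda>t. R3a t l"])
    \<comment> \<open>The factor \<open>real (Y l u)\<close> makes the summand vanish at time steps
      without events.\<close>
    have "?S = (\<Sum>u = 1..<t. real (Y l u) * (K l m + \<alpha> l m * indicator (A l) u) * ?w u)"
      by (rule sum_arrival_times_before[OF t]) simp
    \<comment> \<open>\<open>K l m\<close> and \<open>\<alpha> l m\<close> do not depend on
      \<open>u\<close>, so the sum splits into multiples of the two closed forms.\<close>
    also have "\<dots> = K l m * R3 t l + \<alpha> l m * R3a t l"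
      by (simp add: R3 R3a sum_distrib_left sum.distrib[symmetric] algebra_simps)
    finally show ?thesis .
  qed
  then show "intensity M N Y A h s \<mu> K \<alpha> \<beta> m t =
      \<mu> m * s (h t) + (\<Sum>l = 1..M. K l m * R3 t l) + (\<Sum>l = 1..M. \<alpha> l m * R3a t l)"
    by (simp add: intensity_def sum.distrib)
qed

end
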